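(* Consider the EV-charging restless multi-armed bandit (MAB) problem with $N$ regular chargers and $M$ dummy chargers described in the context. 1) Each charger $i\in\{1,\dots,N+M\}$ is indexable, and hence the MAB problem is indexable. 2) When $M=N$, the Whittle's index policy is optimal for the MAB problem $$\sup_{\pi}\ \mathbb{E}_\pi\Big\{\sum_{t=0}^{\infty}\sum_{i=1}^{N+M}\beta^{t}R_{a_i[t]}(\tilde S_i[t])\ \Big|\ \tilde S_i[0],\ i=1,\dots,N+M\Big\}\quad\text{s.t.}\quad \sum_{i=1}^{N+M}a_i[t]=M\ \ \forall t .$$ 3) If $c[t]=c_0$ for all $t$, the Whittle's index of a regular charger $i\in\{1,\dots,N\}$ is given by $$\nu_i(T,B,c_0,\tau)=\begin{cases}0 & \text{if } B=0,\\ 1-c_0 & \text{if } 1\le B\le T-1,\\ 1-c_0+\beta^{T-1}\,[F(B-T+1)-F(B-T)] & \text{if } T\le B,\end{cases}$$ and the Whittle's index of a dummy charger is zero: $\nu_i(0,0,c_0,\tau)=0$ for $i\in\{N+1,\dots,N+M\}$.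
   Context: Model. Time is discrete, $t=0,1,2,\dots$; $0<\beta<1$ is a discount factor; $1\le M\le N$ are integers. $F$ is an increasing convex penalty function with $F(0)=0$. Charging cost: $c[t]$ is an exogenous Markov chain on a finite set $\mathcal S_c=\{c_j\}$ of real numbers with transition matrix $P=[P_{j,k}]$, common to all chargers and independent of actions. Period index: $\tau[t]=t \bmod N_\tau$, so $\tau$ moves deterministically to $\{\tau+1\}:=(\tau+1)\bmod N_\tau$. Regular chargers $i\in\{1,\dots,N\}$: the state is $S_i=(T,B)$, where $T$ is the lead time to the deadline and $B$ is the remaining charging demand (nonnegative integers). The state is $(0,0)$ if no vehicle is attached; otherwise $1\le T\le\bar T$, $0\le B\le\bar B$. The action is $a\in\{0,1\}$ ($1$ = active, $0$ = passive). The extended state is $\tilde S_i=(S_i,c,\tau)=(T,B,c,\tau)$. Transitions of $S_i$ from $(T,B)$ in period $\tau$ under action $a$: if $T>1$ and $B>0$, to $(T-1,B-a)$; if $T>1$ and $B=0$, to $(T-1,0)$; if $T\le 1$, to $(0,0)$ with probability $1-\rho_i^\tau$ and to $(T',B')$ with probability $\rho_i^\tau Q_i^\tau(T',B')$, where $\rho_i^\tau\in[0,1]$ is an arrival probability and $Q_i^\tau$ is a probability mass function on $\{1,\dots,\bar T\}\times\{1,\dots,\bar B\}$. Arrivals are independent (across chargers and time, and of the cost process). Reward under action $a$ when the cost is $c$: $R_a(\tilde s)=(1-c)a$ if $B>0,T>1$; $R_a(\tilde s)=(1-c)a-F(B-a)$ if $B>0,T=1$; $R_a(\tilde s)=0$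 otherwise. Dummy chargers $i\in\{N+1,\dots,N+M\}$: the state $S_i$ is always $(0,0)$ and the reward is always $0$ under either action; the extended state is $(0,0,c,\tau)$, with $c$ evolving, independently of actions, as the common exogenous Markov chain on $\mathcal S_c$ with transition matrix $P=[P_{j,k}]$, and $\tau$ moving deterministically to $(\tau+1)\bmod N_\tau$. Denote by $\tilde{\mathcal S}_i$ the extended state space of charger $i$. In the MAB problem all $N+M$ chargers (arms) share the same $c[t]$ and $\tau[t]$, and policies $\pi$ choose actions $a_i[t]$ nonanticipatively. $\nu$-subsidy problem for a single charger $i$ (no activation constraint): for $\nu\in\mathbb R$, an extra reward $\nu$ is received whenever the passive action is taken. Its value function $V_i^\nu$ (maximal expected discounted reward) satisfies $$V_i^\nu(\tilde s)=\max\{R_0(\tilde s)+\nu+\beta(\mathcal L_0V_i^\nu)(\tilde s),\ R_1(\tilde s)+\beta(\mathcal L_1V_i^\nu)(\tilde s)\},$$ where $(\mathcal L_a f)(\tilde s)=\mathbb E\{f(\tilde S_i[t+1])\mid\tilde S_i[t]=\tilde s,\ a_i[t]=a\}$. Indexability: let $\tilde{\mathcal S}_i(\nu)$ be the set of extended states $\tilde s$ at which the passive action is optimal in the $\nu$-subsidy problem, i.e. the first term in the maximum is greater than or equal to the second. Charger $i$ is indexable if $\tilde{\mathcal S}_i(\nu)$ increases monotonically from $\emptyset$ to $\tilde{\mathcal S}_i$ as $\nu$ increases from $-\infty$ to $+\infty$. The MAB problem is indexable if all chargers are indexable. Whittle's index: for an indexable charger, $$\nu_i(\tilde s)=\inf\{\nu:\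 R_0(\tilde s)+\nu+\beta(\mathcal L_0V_i^\nu)(\tilde s)\ge R_1(\tilde s)+\beta(\mathcal L_1V_i^\nu)(\tilde s)\}.$$ Whittle's index policy: at each time, sort all $N+M$ chargers by their current Whittle's index in descending order (ties broken arbitrarily) and activate the first $M$.
   Formalization: In part 3, the case 1 ≤ B ≤ T−1 (index 1−c_0) is proved only for c_0 ≤ 1; for c_0 > 1 the stated formula is false (e.g. T=2, B=1, c_0=2, β=1/2, F(x)=10x gives index −1/2, not −1). *)

theory Defs
  imports "HOL-Probability.Probability" "HOL-Probability.Product_PMF"
begin

section \<open>Discounted Markov decision problems\<close>

text \<open>
  A policy is nonanticipative, possibly randomized: it maps the past states and actions and the
  current state to a distribution over actions.
\<close>

type_synonym ('s, 'a) policy = "('s \<times> 'a) list \<Rightarrow> 's \<Rightarrow> 'a pmf"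

definition policies :: "('s \<Rightarrow> 'a set) \<Rightarrow> ('s, 'a) policy set" where
  "policies A = {\<pi>. \<forall>h s. set_pmf (\<pi> h s) \<subseteq> A s}"

text \<open>
  Joint law of the history before time \<open>t\<close> and the state at time \<open>t\<close>, for transition kernel \<open>K\<close>
  (arguments: state, action), policy \<open>\<pi>\<close> and initial state \<open>s0\<close>.
\<close>

primrec hist_pmf ::
  "('s \<Rightarrow> 'a \<Rightarrow> 's pmf) \<Rightarrow> ('s, 'a) policy \<Rightarrow> 's \<Rightarrow> nat \<Rightarrow> (('s \<times> 'a) list \<times> 's) pmf" where
  "hist_pmf K \<pi> s0 0 = return_pmf ([], s0)"
| "hist_pmf K \<pi> s0 (Suc t) =
     bind_pmf (hist_pmf K \<pi> s0 t) (\<lambda>(h, s).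
       bind_pmf (\<pi> h s) (\<lambda>a.
         map_pmf (\<lambda>s'. (h @ [(s, a)], s')) (K s a)))"

definition state_action_pmf ::
  "('s \<Rightarrow> 'a \<Rightarrow> 's pmf) \<Rightarrow> ('s, 'a) policy \<Rightarrow> 's \<Rightarrow> nat \<Rightarrow> ('s \<times> 'a) pmf" where
  "state_action_pmf K \<pi> s0 t =
     bind_pmf (hist_pmf K \<pi> s0 t) (\<lambda>(h, s). map_pmf (\<lambda>a. (s, a)) (\<pi> h s))"

text \<open>
  Expected total discounted reward. All rewards used below are bounded along the process, so the
  series converges absolutely and summation and expectation may be interchanged.
\<close>

definition policy_value ::
  "real \<Rightarrow> ('s \<Rightarrow> 'a \<Rightarrow> 's pmf) \<Rightarrow> ('s \<Rightarrow> 'a \<Rightarrow> real) \<Rightarrow> ('s, 'a) policy \<Rightarrow> 's \<Rightarrow> real" where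
  "policy_value \<beta> K r \<pi> s0 =
     (\<Sum>t. \<beta> ^ t * measure_pmf.expectation (state_action_pmf K \<pi> s0 t) (\<lambda>(s, a). r s a))"

definition optimal_value ::
  "real \<Rightarrow> ('s \<Rightarrow> 'a \<Rightarrow> 's pmf) \<Rightarrow> ('s \<Rightarrow> 'a \<Rightarrow> real) \<Rightarrow> ('s \<Rightarrow> 'a set) \<Rightarrow> 's \<Rightarrow> real" where
  "optimal_value \<beta> K r A s0 = (SUP \<pi>\<in>policies A. policy_value \<beta> K r \<pi> s0)"

definition optimal_policy_from ::
  "real \<Rightarrow> ('s \<Rightarrow> 'a \<Rightarrow> 's pmf) \<Rightarrow> ('s \<Rightarrow> 'a \<Rightarrow> real) \<Rightarrow> ('s \<Rightarrow> 'a set) \<Rightarrow> ('s, 'a) policy \<Rightarrow> 's \<Rightarrow> bool"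
  where
  "optimal_policy_from \<beta> K r A \<pi> s0 \<longleftrightarrow>
     \<pi> \<in> policies A \<and> (\<forall>\<pi>'\<in>policies A. policy_value \<beta> K r \<pi>' s0 \<le> policy_value \<beta> K r \<pi> s0)"


section \<open>The charging model\<close>

text \<open>
  The entry \<open>P c c'\<close> of the transition matrix of the charging cost is \<open>pmf (cost_trans E c) c'\<close>.
  The penalty function is only used on nonnegative arguments and need not be strictly increasing.
  In \<open>arr_prob E i \<tau>\<close> and \<open>arr_dist E i \<tau>\<close>, \<open>i\<close> is the charger and \<open>\<tau>\<close> the period.
\<close>

record ev_model =
  disc :: real
  num_active :: nat
  num_regular :: nat
  penalty :: "real \<Rightarrow> real"
  costs :: "real set"
  cost_trans :: "real \<Rightarrow> real pmf"
  num_periods :: nat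
  max_lead :: nat
  max_demand :: nat
  arr_prob :: "nat \<Rightarrow> nat \<Rightarrow> real"
  arr_dist :: "nat \<Rightarrow> nat \<Rightarrow> (nat \<times> nat) pmf"

definition valid_ev_model :: "ev_model \<Rightarrow> bool" where
  "valid_ev_model E \<longleftrightarrow>
     0 < disc E \<and> disc E < 1 \<and>
     1 \<le> num_active E \<and> num_active E \<le> num_regular E \<and>
     mono_on {0..} (penalty E) \<and> convex_on {0..} (penalty E) \<and> penalty E 0 = 0 \<and>
     finite (costs E) \<and> costs E \<noteq> {} \<and>
     (\<forall>c\<in>costs E. set_pmf (cost_trans E c) \<subseteq> costs E) \<and>
     1 \<le> num_periods E \<and>
     (\<forall>i\<in>{1..num_regular E}. \<forall>\<tau><num_periods E.
        0 \<le> arr_prob E i \<tau> \<and> arr_prob E i \<tau> \<le> 1 \<and>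
        set_pmf (arr_dist E i \<tau>) \<subseteq> {1..max_lead E} \<times> {1..max_demand E})"

definition regular :: "ev_model \<Rightarrow> nat set" where
  "regular E = {1..num_regular E}"

definition dummy :: "ev_model \<Rightarrow> nat set" where
  "dummy E = {num_regular E + 1..num_regular E + num_active E}"

definition arms :: "ev_model \<Rightarrow> nat set" where
  "arms E = {1..num_regular E + num_active E}"


subsection \<open>A single charger\<close>

text \<open>Charger states are pairs \<open>(T, B)\<close>; extended states are \<open>((T, B), c, \<tau>)\<close>.\<close>

type_synonym arm_state = "nat \<times> nat"
type_synonym ext_state = "arm_state \<times> real \<times> nat"

definition arm_space :: "ev_model \<Rightarrow> nat \<Rightarrow> arm_state set" where
  "arm_space E i =
     (if i \<in> regular E then insert (0, 0) ({1..max_lead E} \<times> {0..max_demand E}) else {(0, 0)})"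

definition ext_space :: "ev_model \<Rightarrow> nat \<Rightarrow> ext_state set" where
  "ext_space E i = arm_space E i \<times> costs E \<times> {0..<num_periods E}"

definition arm_trans :: "ev_model \<Rightarrow> nat \<Rightarrow> nat \<Rightarrow> nat \<Rightarrow> arm_state \<Rightarrow> arm_state pmf" where
  "arm_trans E i \<tau> a = (\<lambda>(T, B).
     if i \<in> regular E then
       if T > 1 \<and> B > 0 then return_pmf (T - 1, B - a)
       else if T > 1 then return_pmf (T - 1, 0)
       else bind_pmf (bernoulli_pmf (arr_prob E i \<tau>))
              (\<lambda>arrival. if arrival then arr_dist E i \<tau> else return_pmf (0, 0))
     else return_pmf (0, 0))"

definition next_period :: "ev_model \<Rightarrow> nat \<Rightarrow> nat" where
  "next_period E \<tau> = (\<tau> + 1) mod num_periods E"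

definition ext_trans :: "ev_model \<Rightarrow> nat \<Rightarrow> ext_state \<Rightarrow> nat \<Rightarrow> ext_state pmf" where
  "ext_trans E i = (\<lambda>(S, c, \<tau>) a.
     map_pmf (\<lambda>(S', c'). (S', c', next_period E \<tau>))
       (pair_pmf (arm_trans E i \<tau> a S) (cost_trans E c)))"

definition reward :: "ev_model \<Rightarrow> nat \<Rightarrow> nat \<Rightarrow> ext_state \<Rightarrow> real" where
  "reward E i a = (\<lambda>((T, B), c, \<tau>).
     if i \<in> regular E then
       if B > 0 \<and> T > 1 then (1 - c) * real a
       else if B > 0 \<and> T = 1 then (1 - c) * real a - penalty E (real (B - a))
       else 0
     else 0)"


subsection \<open>Subsidy problem, indexability and Whittle's index\<close>

definition subsidy_reward :: "ev_model \<Rightarrow> nat \<Rightarrow> real \<Rightarrow> ext_state \<Rightarrow> nat \<Rightarrow> real" where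
  "subsidy_reward E i \<nu> s a = reward E i a s + (if a = 0 then \<nu> else 0)"

definition subsidy_value :: "ev_model \<Rightarrow> nat \<Rightarrow> real \<Rightarrow> ext_state \<Rightarrow> real" where
  "subsidy_value E i \<nu> =
     optimal_value (disc E) (ext_trans E i) (subsidy_reward E i \<nu>) (\<lambda>_. {0, 1})"

definition expected_next ::
  "ev_model \<Rightarrow> nat \<Rightarrow> nat \<Rightarrow> (ext_state \<Rightarrow> real) \<Rightarrow> ext_state \<Rightarrow> real" where
  "expected_next E i a f s = measure_pmf.expectation (ext_trans E i s a) f"

definition passive_optimal :: "ev_model \<Rightarrow> nat \<Rightarrow> real \<Rightarrow> ext_state \<Rightarrow> bool" where
  "passive_optimal E i \<nu> s \<longleftrightarrow>
     reward E i 0 s + \<nu> + disc E * expected_next E i 0 (subsidy_value E i \<nu>) s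
     \<ge> reward E i 1 s + disc E * expected_next E i 1 (subsidy_value E i \<nu>) s"

definition passive_set :: "ev_model \<Rightarrow> nat \<Rightarrow> real \<Rightarrow> ext_state set" where
  "passive_set E i \<nu> = {s \<in> ext_space E i. passive_optimal E i \<nu> s}"

text \<open>
  As the extended state space is finite, increasing from the empty set to the whole space means
  that both extremes are attained for subsidies sufficiently small and sufficiently large.
\<close>

definition indexable :: "ev_model \<Rightarrow> nat \<Rightarrow> bool" where
  "indexable E i \<longleftrightarrow>
     mono (passive_set E i) \<and>
     (\<forall>\<^sub>F \<nu> in at_bot. passive_set E i \<nu> = {}) \<and>
     (\<forall>\<^sub>F \<nu> in at_top. passive_set E i \<nu> = ext_space E i)"

definition mab_indexable :: "ev_model \<Rightarrow> bool" where
  "mab_indexable E \<longleftrightarrow> (\<forall>i\<in>arms E. indexable E i)"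

definition whittle_index :: "ev_model \<Rightarrow> nat \<Rightarrow> ext_state \<Rightarrow> real" where
  "whittle_index E i s = Inf {\<nu>. passive_optimal E i \<nu> s}"


subsection \<open>The multi-armed bandit problem\<close>

text \<open>
  A joint state consists of the charger states and the common cost and period. Charger states are
  \<open>(0, 0)\<close> and actions are \<open>undefined\<close> outside the index set of the arms.
\<close>

type_synonym mab_state = "(nat \<Rightarrow> arm_state) \<times> real \<times> nat"
type_synonym mab_action = "nat \<Rightarrow> nat"

definition mab_space :: "ev_model \<Rightarrow> mab_state set" where
  "mab_space E = PiE_dflt (arms E) (0, 0) (arm_space E) \<times> costs E \<times> {0..<num_periods E}"

definition mab_actions :: "ev_model \<Rightarrow> mab_action set" where
  "mab_actions E = {a \<in> PiE (arms E) (\<lambda>_. {0, 1}). (\<Sum>i\<in>arms E. a i) = num_active E}"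

definition mab_trans :: "ev_model \<Rightarrow> mab_state \<Rightarrow> mab_action \<Rightarrow> mab_state pmf" where
  "mab_trans E = (\<lambda>(S, c, \<tau>) a.
     map_pmf (\<lambda>(S', c'). (S', c', next_period E \<tau>))
       (pair_pmf (Pi_pmf (arms E) (0, 0) (\<lambda>i. arm_trans E i \<tau> (a i) (S i))) (cost_trans E c)))"

definition mab_reward :: "ev_model \<Rightarrow> mab_state \<Rightarrow> mab_action \<Rightarrow> real" where
  "mab_reward E = (\<lambda>(S, c, \<tau>) a. \<Sum>i\<in>arms E. reward E i (a i) (S i, c, \<tau>))"

definition mab_optimal :: "ev_model \<Rightarrow> (mab_state, mab_action) policy \<Rightarrow> mab_state \<Rightarrow> bool" where
  "mab_optimal E =
     optimal_policy_from (disc E) (mab_trans E) (mab_reward E) (\<lambda>_. mab_actions E)"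

text \<open>
  The actions obtained by activating the first \<open>num_active E\<close> chargers of some list that sorts
  all chargers by descending index; different lists correspond to different ways of breaking ties.
\<close>

definition whittle_actions :: "ev_model \<Rightarrow> mab_state \<Rightarrow> mab_action set" where
  "whittle_actions E = (\<lambda>(S, c, \<tau>).
     {a \<in> mab_actions E. \<exists>xs. distinct xs \<and> set xs = arms E \<and>
        sorted_wrt (\<lambda>i j. whittle_index E i (S i, c, \<tau>) \<ge> whittle_index E j (S j, c, \<tau>)) xs \<and>
        {i \<in> arms E. a i = 1} = set (take (num_active E) xs)})"

text \<open>Ties may be broken in a way that depends on the history and on randomization.\<close>

definition whittle_policy :: "ev_model \<Rightarrow> (mab_state, mab_action) policy \<Rightarrow> bool" where
  "whittle_policy E \<pi> \<longleftrightarrow>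
     \<pi> \<in> policies (\<lambda>_. mab_actions E) \<and>
     (\<forall>h. \<forall>s\<in>mab_space E. set_pmf (\<pi> h s) \<subseteq> whittle_actions E s)"

end

theory Submission
  imports Defs
begin

text \<open>
  Dynamic programming turns every claim into one about the one-step comparison of the two actions.
  For a single charger, being active with demand \<open>B > 0\<close> amounts to earning \<open>1 - c\<close> and then
  continuing as a passive charger with demand \<open>B - 1\<close> (\<open>net_value_active\<close>). Subtracting the
  Bellman equations at two neighbouring demands therefore cancels everything that depends on
  future arrivals, and the advantage of the active over the unsubsidized passive action satisfies
  a closed recursion (\<open>activation_gain\<close>) in the lead time, the demand and the charging cost alone.
  The passive action is optimal at subsidy \<open>\<nu>\<close> if and only if this gain \<open>g \<nu>\<close> is at most \<open>\<nu>\<close>.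

  Indexability. The recursion shows \<open>g \<nu>' - g \<nu> \<le> \<beta> (\<nu>' - \<nu>)\<close> for \<open>\<nu> \<le> \<nu>'\<close>, so \<open>\<nu> - g \<nu>\<close> grows at
  least at rate \<open>1 - \<beta> > 0\<close>; it is also continuous. Hence \<open>g\<close> has exactly one fixed point, this
  fixed point is Whittle's index, and the passive action is optimal exactly for subsidies at or above
  it, the active action exactly for subsidies at or below it.

  Optimality for \<open>M = N\<close>. Half of the chargers are dummies of index \<open>0\<close>, and half of all chargers
  are activated. So the index policy activates no charger of negative index and leaves none of
  positive index passive: every charger takes an action that is optimal for it at subsidy \<open>0\<close>. The
  sum of the individual optimal values at subsidy \<open>0\<close> bounds the value of every policy, as the
  activation constraint only removes actions, and the index policy attains it.

  Constant cost. At the claimed index, induction on the lead time decides every maximum and minimum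
  in the recursion, by \<open>c \<le> 1\<close> and the monotonicity of the penalty if the vehicle has slack
  (\<open>activation_gain_slack\<close>), by the monotonicity and convexity of the penalty if it has none
  (\<open>activation_gain_tight\<close>). The claimed index thus is a fixed point of the gain, and the fixed point
  is unique.
\<close>

section \<open>Finite discounted Markov decision problems\<close>

lemma expectation_bind_finite:
  fixes f :: "'b \<Rightarrow> real"
  assumes "finite (set_pmf p)" "\<And>x. x \<in> set_pmf p \<Longrightarrow> finite (set_pmf (q x))"
  shows "measure_pmf.expectation (bind_pmf p q) f =
    measure_pmf.expectation p (\<lambda>x. measure_pmf.expectation (q x) f)"
proof -
  have "measure_pmf.expectation (bind_pmf p q) f =
      (\<Sum>x\<in>set_pmf p. pmf p x *\<^sub>R measure_pmf.expectation (q x) f)"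
    using assms by (intro pmf_expectation_bind) auto
  also have "\<dots> = measure_pmf.expectation p (\<lambda>x. measure_pmf.expectation (q x) f)"
    using assms(1) by (subst integral_measure_pmf[of "set_pmf p"]) auto
  finally show ?thesis .
qed

lemma expectation_cong_pmf:
  assumes "\<And>x. x \<in> set_pmf p \<Longrightarrow> f x = (g x :: real)"
  shows "measure_pmf.expectation p f = measure_pmf.expectation p g"
  using assms by (intro integral_cong_AE) (auto simp: AE_measure_pmf_iff)

lemma tendsto_Max:
  fixes f :: "'i \<Rightarrow> 'x \<Rightarrow> real"
  assumes "finite I" "I \<noteq> {}" "\<And>i. i \<in> I \<Longrightarrow> (f i \<longlongrightarrow> l i) F"
  shows "((\<lambda>x. Max ((\<lambda>i. f i x) ` I)) \<longlongrightarrow> Max (l ` I)) F"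
  using assms
proof (induction I rule: finite_ne_induct)
  case (singleton i)
  then show ?case by simp
next
  case (insert i I)
  have "((\<lambda>x. max (f i x) (Max ((\<lambda>i. f i x) ` I))) \<longlongrightarrow> max (l i) (Max (l ` I))) F"
    using insert by (intro tendsto_max) auto
  then show ?case using insert by simp
qed

locale finite_discounted_mdp =
  fixes \<beta> :: real
    and K :: "'s \<Rightarrow> 'a \<Rightarrow> 's pmf"
    and r :: "'s \<Rightarrow> 'a \<Rightarrow> real"
    and A :: "'s \<Rightarrow> 'a set"
    and X :: "'s set"
  assumes discount: "0 < \<beta>" "\<beta> < 1"
    and finite_states: "finite X"
    and finite_actions: "\<And>s. finite (A s)"
    and closed: "\<And>s a. s \<in> X \<Longrightarrow> a \<in> A s \<Longrightarrow> set_pmf (K s a) \<subseteq> X"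
begin

definition q_value :: "('s \<Rightarrow> real) \<Rightarrow> 's \<Rightarrow> 'a \<Rightarrow> real" where
  "q_value w s a = r s a + \<beta> * measure_pmf.expectation (K s a) w"

lemma expectation_next:
  assumes "s \<in> X" "a \<in> A s"
  shows "measure_pmf.expectation (K s a) w = (\<Sum>x\<in>X. w x * pmf (K s a) x)"
  using closed[OF assms] finite_states by (intro integral_measure_pmf_real) auto

lemma q_value_cong:
  assumes "s \<in> X" "a \<in> A s" "\<And>x. x \<in> X \<Longrightarrow> v x = w x"
  shows "q_value v s a = q_value w s a"
  using assms by (simp add: q_value_def expectation_next)

lemma q_value_mono:
  assumes "s \<in> X" "a \<in> A s" "\<And>x. x \<in> X \<Longrightarrow> v x \<le> w x"
  shows "q_value v s a \<le> q_value w s a"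
  using assms discount
  by (auto simp: q_value_def expectation_next intro!: mult_left_mono sum_mono mult_right_mono)

lemma q_value_const: "q_value (\<lambda>_. d) s a = r s a + \<beta> * d"
  by (simp add: q_value_def)

lemma finite_state_actions: "finite (Sigma X A)"
  using finite_states finite_actions by auto

lemma reward_bound: obtains C where "0 \<le> C" "\<And>s a. s \<in> X \<Longrightarrow> a \<in> A s \<Longrightarrow> \<bar>r s a\<bar> \<le> C"
proof
  let ?C = "\<Sum>(s, a)\<in>Sigma X A. \<bar>r s a\<bar>"
  show "0 \<le> ?C" by (intro sum_nonneg) auto
  show "\<bar>r s a\<bar> \<le> ?C" if "s \<in> X" "a \<in> A s" for s a
    using member_le_sum[of "(s, a)" "Sigma X A" "\<lambda>(s, a). \<bar>r s a\<bar>"] that finite_state_actions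
    by auto
qed


subsection \<open>The performance difference identity\<close>

lemma hist_support:
  assumes "\<pi> \<in> policies A" "s0 \<in> X"
  shows "finite (set_pmf (hist_pmf K \<pi> s0 t)) \<and> set_pmf (hist_pmf K \<pi> s0 t) \<subseteq> UNIV \<times> X"
proof (induction t)
  case 0
  then show ?case using assms by simp
next
  case (Suc t)
  have act: "set_pmf (\<pi> h s) \<subseteq> A s" for h s
    using assms(1) by (auto simp: policies_def)
  have "finite (set_pmf (\<pi> h s))" for h s
    using act finite_actions finite_subset by blast
  moreover have "finite (set_pmf (K s a))" if "s \<in> X" "a \<in> set_pmf (\<pi> h s)" for h s a
    using closed[OF that(1), of a] act that(2) finite_states finite_subset by blast
  ultimately have "finite (set_pmf (hist_pmf K \<pi> s0 (Suc t)))"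
    using Suc by (auto simp: set_bind_pmf)
  moreover have "set_pmf (hist_pmf K \<pi> s0 (Suc t)) \<subseteq> UNIV \<times> X"
    using Suc act closed by (fastforce simp: set_bind_pmf)
  ultimately show ?case ..
qed

lemma state_action_support:
  assumes "\<pi> \<in> policies A" "s0 \<in> X"
  shows "set_pmf (state_action_pmf K \<pi> s0 t) \<subseteq> Sigma X A"
  using hist_support[OF assms, of t] assms(1)
  by (fastforce simp: state_action_pmf_def set_bind_pmf policies_def)

lemma finite_state_action_support:
  assumes "\<pi> \<in> policies A" "s0 \<in> X"
  shows "finite (set_pmf (state_action_pmf K \<pi> s0 t))"
  using state_action_support[OF assms] finite_state_actions finite_subset by blast

lemma state_law_current:
  "map_pmf snd (hist_pmf K \<pi> s0 t) = map_pmf fst (state_action_pmf K \<pi> s0 t)"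
  by (simp add: state_action_pmf_def map_bind_pmf split_def map_pmf_comp)
     (simp add: map_pmf_def)

lemma state_law_next:
  "map_pmf snd (hist_pmf K \<pi> s0 (Suc t)) =
     bind_pmf (state_action_pmf K \<pi> s0 t) (\<lambda>(s, a). K s a)"
  by (simp add: state_action_pmf_def map_bind_pmf split_def map_pmf_comp bind_assoc_pmf bind_map_pmf)

text \<open>
  A policy loses, against a candidate value function \<open>w\<close>, exactly the discounted shortfalls
  \<open>w s - q_value w s a\<close> of the actions that it takes: the terms in \<open>w\<close> telescope along the process,
  and their remainder vanishes by discounting. Both directions of dynamic programming follow,
  as upper bounds (nonnegative shortfalls) and as optimality (zero shortfalls).
\<close>

theorem performance_difference:
  assumes "\<pi> \<in> policies A" "s0 \<in> X"
  shows "(\<lambda>t. \<beta> ^ t * measure_pmf.expectation (state_action_pmf K \<pi> s0 t)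
                (\<lambda>(s, a). w s - q_value w s a))
         sums (w s0 - policy_value \<beta> K r \<pi> s0)"
proof -
  let ?p = "\<lambda>t. state_action_pmf K \<pi> s0 t"
  define R where "R t = measure_pmf.expectation (?p t) (\<lambda>(s, a). r s a)" for t
  define W where "W t = measure_pmf.expectation (map_pmf snd (hist_pmf K \<pi> s0 t)) w" for t
  note supp = state_action_support[OF assms] and fin = finite_state_action_support[OF assms]
  have int: "integrable (measure_pmf (?p t)) f" for t and f :: "'s \<times> 'a \<Rightarrow> real"
    using fin by (rule integrable_measure_pmf_finite)
  have W_now: "W t = measure_pmf.expectation (?p t) (\<lambda>(s, a). w s)" for t
    by (simp add: W_def state_law_current split_def)
  have W_next: "W (Suc t) =
      measure_pmf.expectation (?p t) (\<lambda>(s, a). measure_pmf.expectation (K s a) w)" for t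
    unfolding W_def state_law_next
  proof (subst expectation_bind_finite[OF fin], goal_cases)
    case (1 x)
    then have "fst x \<in> X" "snd x \<in> A (fst x)"
      using supp[of t] by auto
    then show ?case
      using finite_subset[OF closed finite_states] by (simp add: split_def)
  next
    case 2
    then show ?case by (simp add: split_def)
  qed
  have gap: "measure_pmf.expectation (?p t) (\<lambda>(s, a). w s - q_value w s a) =
      W t - R t - \<beta> * W (Suc t)" for t
    by (simp add: W_now[of t] W_next R_def q_value_def split_def int diff_diff_eq)
  obtain C where C: "0 \<le> C" "\<And>s a. s \<in> X \<Longrightarrow> a \<in> A s \<Longrightarrow> \<bar>r s a\<bar> \<le> C"
    by (rule reward_bound) blast
  have R_bound: "\<bar>R t\<bar> \<le> C" for t
  proof -
    have "\<bar>R t\<bar> \<le> measure_pmf.expectation (?p t) (\<lambda>(s, a). \<bar>r s a\<bar>)"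
      unfolding R_def using integral_abs_bound[of "?p t" "\<lambda>(s, a). r s a"] by (simp add: split_def)
    also have "\<dots> \<le> measure_pmf.expectation (?p t) (\<lambda>_. C)"
      using supp[of t] C(2) by (intro integral_mono_AE int AE_pmfI) auto
    finally show ?thesis by simp
  qed
  define D where "D = (\<Sum>s\<in>X. \<bar>w s\<bar>)"
  have W_bound: "\<bar>W t\<bar> \<le> D" for t
  proof -
    have "\<bar>W t\<bar> \<le> measure_pmf.expectation (?p t) (\<lambda>(s, a). \<bar>w s\<bar>)"
      unfolding W_now using integral_abs_bound[of "?p t" "\<lambda>(s, a). w s"] by (simp add: split_def)
    also have "\<dots> \<le> measure_pmf.expectation (?p t) (\<lambda>_. D)"
    proof (intro integral_mono_AE int AE_pmfI)
      fix x assume "x \<in> set_pmf (?p t)"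
      then have "fst x \<in> X" using supp[of t] by auto
      then have "\<bar>w (fst x)\<bar> \<le> D"
        unfolding D_def using finite_states by (intro member_le_sum) auto
      then show "(case x of (s, a) \<Rightarrow> \<bar>w s\<bar>) \<le> D"
        by (simp add: split_def)
    qed
    finally show ?thesis by simp
  qed
  have summ: "summable (\<lambda>t. \<beta> ^ t * R t)"
  proof (rule summable_comparison_test')
    show "summable (\<lambda>t. \<beta> ^ t * C)"
      using discount by (intro summable_mult2 summable_geometric) auto
    show "norm (\<beta> ^ t * R t) \<le> \<beta> ^ t * C" if "0 \<le> t" for t
      using discount R_bound[of t] by (simp add: abs_mult mult_left_mono)
  qed
  have "(\<lambda>t. \<beta> ^ t * W t) \<longlonglongrightarrow> 0"
  proof (rule Lim_null_comparison)
    show "\<forall>\<^sub>F t in sequentially. norm (\<beta> ^ t * W t) \<le> \<beta> ^ t * D"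
      using discount W_bound by (simp add: abs_mult mult_left_mono)
    show "(\<lambda>t. \<beta> ^ t * D) \<longlonglongrightarrow> 0"
      using discount by (intro tendsto_mult_left_zero LIMSEQ_power_zero) auto
  qed
  then have "(\<lambda>t. \<beta> ^ t * W t - \<beta> ^ Suc t * W (Suc t)) sums (\<beta> ^ 0 * W 0 - 0)"
    by (rule telescope_sums')
  moreover have "W 0 = w s0"
    by (simp add: W_def)
  ultimately have "(\<lambda>t. (\<beta> ^ t * W t - \<beta> ^ Suc t * W (Suc t)) - \<beta> ^ t * R t)
      sums (w s0 - (\<Sum>t. \<beta> ^ t * R t))"
    using summ by (intro sums_diff summable_sums) auto
  then show ?thesis
    by (simp add: gap policy_value_def R_def algebra_simps)
qed

corollary policy_value_le:
  assumes "\<pi> \<in> policies A" "s0 \<in> X"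
    and "\<And>s a. s \<in> X \<Longrightarrow> a \<in> A s \<Longrightarrow> q_value w s a \<le> w s"
  shows "policy_value \<beta> K r \<pi> s0 \<le> w s0"
proof -
  have "0 \<le> measure_pmf.expectation (state_action_pmf K \<pi> s0 t) (\<lambda>(s, a). w s - q_value w s a)"
    for t
    using state_action_support[OF assms(1,2), of t] assms(3)
    by (intro integral_nonneg_AE) (auto simp: AE_measure_pmf_iff)
  then have "0 \<le> w s0 - policy_value \<beta> K r \<pi> s0"
    using discount by (intro sums_le[OF _ sums_zero performance_difference[OF assms(1,2)]]) auto
  then show ?thesis by simp
qed

corollary policy_value_eq:
  assumes "\<pi> \<in> policies A" "s0 \<in> X"
    and "\<And>h s a. s \<in> X \<Longrightarrow> a \<in> set_pmf (\<pi> h s) \<Longrightarrow> q_value w s a = w s"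
  shows "policy_value \<beta> K r \<pi> s0 = w s0"
proof -
  have "measure_pmf.expectation (state_action_pmf K \<pi> s0 t) (\<lambda>(s, a). w s - q_value w s a)
      = measure_pmf.expectation (state_action_pmf K \<pi> s0 t) (\<lambda>_. 0)" for t
    using hist_support[OF assms(1,2), of t] assms(3)
    by (intro expectation_cong_pmf) (fastforce simp: state_action_pmf_def set_bind_pmf)
  then have "(\<lambda>t. 0) sums (w s0 - policy_value \<beta> K r \<pi> s0)"
    using performance_difference[OF assms(1,2), of w] by simp
  then show ?thesis
    using sums_unique2[OF sums_zero] by fastforce
qed


subsection \<open>The Bellman equation\<close>

text \<open>
  Value iteration from a constant upper bound decreases and stays above the corresponding lower
  bound, so it converges pointwise. Maxima over finitely many actions and expectations over
  finitely many states commute with the limit, which is therefore a fixed point.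
\<close>

lemma bellman_fixed_point_exists:
  assumes nonempty: "\<And>s. A s \<noteq> {}"
  obtains v where "\<And>s. s \<in> X \<Longrightarrow> v s = Max (q_value v s ` A s)"
proof -
  define T where "T v s = Max (q_value v s ` A s)" for v s
  obtain C where C: "0 \<le> C" "\<And>s a. s \<in> X \<Longrightarrow> a \<in> A s \<Longrightarrow> \<bar>r s a\<bar> \<le> C"
    by (rule reward_bound) blast
  \<comment> \<open>the value of receiving reward \<open>C\<close> in every period\<close>
  define d where "d = C / (1 - \<beta>)"
  have d: "C + \<beta> * d = d"
  proof -
    have "(1 - \<beta>) * d = C" using discount by (simp add: d_def)
    then show ?thesis by (simp add: left_diff_distrib)
  qed
  have T_mono: "T v s \<le> T w s" if "s \<in> X" "\<And>x. x \<in> X \<Longrightarrow> v x \<le> w x" for v w s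
  proof -
    have "q_value v s a \<le> T w s" if "a \<in> A s" for a
      using q_value_mono[OF \<open>s \<in> X\<close> that, of v w] \<open>\<And>x. x \<in> X \<Longrightarrow> v x \<le> w x\<close>
        Max_ge[of "q_value w s ` A s" "q_value w s a"] finite_actions that
      unfolding T_def by fastforce
    then show ?thesis
      unfolding T_def[of v] using nonempty finite_actions by (subst Max_le_iff) auto
  qed
  have upper: "T (\<lambda>_. d) s \<le> d" if "s \<in> X" for s
  proof -
    have "q_value (\<lambda>_. d) s a \<le> d" if "a \<in> A s" for a
      using C(2)[OF \<open>s \<in> X\<close> that] d \<open>s \<in> X\<close> that by (simp add: q_value_const abs_le_iff)
    then show ?thesis
      unfolding T_def using nonempty finite_actions by (subst Max_le_iff) auto
  qed
  have lower: "- d \<le> T (\<lambda>_. - d) s" if "s \<in> X" for s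
  proof -
    obtain a where "a \<in> A s" using nonempty by blast
    then have "- d \<le> q_value (\<lambda>_. - d) s a"
      using C(2)[OF that, of a] d that by (simp add: q_value_const abs_le_iff)
    also have "\<dots> \<le> T (\<lambda>_. - d) s"
      unfolding T_def using finite_actions \<open>a \<in> A s\<close> by simp
    finally show ?thesis .
  qed
  define u where "u n = (T ^^ n) (\<lambda>_. d)" for n
  have u_Suc: "u (Suc n) = T (u n)" for n by (simp add: u_def)
  have dec: "s \<in> X \<Longrightarrow> u (Suc n) s \<le> u n s" for n s
  proof (induction n arbitrary: s)
    case 0
    then show ?case using upper by (simp add: u_def)
  next
    case (Suc n)
    then show ?case using T_mono[of s "u (Suc n)" "u n"] by (simp add: u_Suc)
  qed
  have bnd: "s \<in> X \<Longrightarrow> - d \<le> u n s" for n s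
  proof (induction n arbitrary: s)
    case 0
    then show ?case using discount C by (simp add: u_def d_def field_simps)
  next
    case (Suc n)
    then show ?case using lower[of s] T_mono[of s "\<lambda>_. - d" "u n"] by (simp add: u_Suc)
  qed
  have "\<exists>l. (\<lambda>n. u n s) \<longlonglongrightarrow> l" if "s \<in> X" for s
    using decseq_convergent[of "\<lambda>n. u n s" "- d"] dec bnd that
    by (metis decseq_SucI)
  then obtain v where v: "\<And>s. s \<in> X \<Longrightarrow> (\<lambda>n. u n s) \<longlonglongrightarrow> v s" by metis
  show ?thesis
  proof
    fix s assume s: "s \<in> X"
    have "(\<lambda>n. q_value (u n) s a) \<longlonglongrightarrow> q_value v s a" if "a \<in> A s" for a
      using s that v by (auto simp: q_value_def expectation_next intro!: tendsto_intros)
    then have "(\<lambda>n. T (u n) s) \<longlonglongrightarrow> T v s"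
      unfolding T_def using finite_actions nonempty by (intro tendsto_Max) auto
    moreover have "(\<lambda>n. T (u n) s) \<longlonglongrightarrow> v s"
      using LIMSEQ_Suc[OF v[OF s]] by (simp add: u_Suc)
    ultimately show "v s = Max (q_value v s ` A s)"
      using LIMSEQ_unique unfolding T_def by blast
  qed
qed

text \<open>
  By the performance difference identity, a fixed point dominates every policy value and is attained
  by a policy that is greedy with respect to it, so it agrees with the optimal value.
\<close>

theorem bellman_equation:
  assumes nonempty: "\<And>s. A s \<noteq> {}" and s: "s \<in> X"
  shows "optimal_value \<beta> K r A s = Max (q_value (optimal_value \<beta> K r A) s ` A s)"
proof -
  obtain v where v: "\<And>s. s \<in> X \<Longrightarrow> v s = Max (q_value v s ` A s)"
    using bellman_fixed_point_exists[OF nonempty] by blast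
  have le: "q_value v s a \<le> v s" if "s \<in> X" "a \<in> A s" for s a
    using that v[OF that(1)] finite_actions by simp
  have "\<exists>a\<in>A s. s \<in> X \<longrightarrow> q_value v s a = v s" for s
    using Max_in[of "q_value v s ` A s"] nonempty[of s] finite_actions v[of s] by fastforce
  then obtain g where g: "\<And>s. g s \<in> A s" "\<And>s. s \<in> X \<Longrightarrow> q_value v s (g s) = v s"
    by metis
  have greedy: "(\<lambda>h s. return_pmf (g s)) \<in> policies A"
    using g by (auto simp: policies_def)
  have opt: "optimal_value \<beta> K r A s = v s" if "s \<in> X" for s
    unfolding optimal_value_def
  proof (rule cSup_eq_maximum)
    show "v s \<in> (\<lambda>\<pi>. policy_value \<beta> K r \<pi> s) ` policies A"
      using greedy policy_value_eq[OF greedy that, of v] g by force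
    show "x \<le> v s" if "x \<in> (\<lambda>\<pi>. policy_value \<beta> K r \<pi> s) ` policies A" for x
      using that policy_value_le[OF _ \<open>s \<in> X\<close>, of _ v] le by auto
  qed
  have "q_value v s a = q_value (optimal_value \<beta> K r A) s a" if "a \<in> A s" for a
    using s that opt by (intro q_value_cong) auto
  then show ?thesis
    using opt[OF s] v[OF s] by (simp cong: image_cong_simp)
qed

end

section \<open>The activation gain of a single charger\<close>

definition net_value :: "ev_model \<Rightarrow> nat \<Rightarrow> real \<Rightarrow> nat \<Rightarrow> ext_state \<Rightarrow> real" where
  "net_value E i \<nu> a s = reward E i a s + disc E * expected_next E i a (subsidy_value E i \<nu>) s"

lemma passive_optimal_net_value:
  "passive_optimal E i \<nu> s \<longleftrightarrow> net_value E i \<nu> 1 s \<le> net_value E i \<nu> 0 s + \<nu>"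
  by (auto simp: passive_optimal_def net_value_def)

text \<open>
  The advantage of the active over the passive action, not counting the subsidy, at lead time
  \<open>n + 1\<close>, as \<open>net_value_gain\<close> shows. The expectation is over the loss of value, one period later,
  from having demand \<open>b + 1\<close> instead of \<open>b\<close>. Indexing by \<open>n\<close> makes the period at the deadline
  the base case.
\<close>

fun activation_gain :: "ev_model \<Rightarrow> real \<Rightarrow> nat \<Rightarrow> nat \<Rightarrow> real \<Rightarrow> real" where
  "activation_gain E \<nu> n 0 c = 0"
| "activation_gain E \<nu> 0 (Suc b) c = 1 - c + (penalty E (real (Suc b)) - penalty E (real b))"
| "activation_gain E \<nu> (Suc n) (Suc b) c = 1 - c + disc E * measure_pmf.expectation (cost_trans E c)
     (\<lambda>c'. max \<nu> (activation_gain E \<nu> n b c') - (1 - c')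
           + min (activation_gain E \<nu> n (Suc b) c' - \<nu>) 0)"

locale ev_charging =
  fixes E :: ev_model
  assumes valid: "valid_ev_model E"
begin

lemma discount: "0 < disc E" "disc E < 1"
  using valid by (auto simp: valid_ev_model_def)

lemma finite_costs: "finite (costs E)"
  using valid by (auto simp: valid_ev_model_def)

lemma cost_trans_closed: "c \<in> costs E \<Longrightarrow> set_pmf (cost_trans E c) \<subseteq> costs E"
  using valid by (auto simp: valid_ev_model_def)

lemma penalty_zero: "penalty E 0 = 0"
  using valid by (auto simp: valid_ev_model_def)

lemma next_period_less: "next_period E \<tau> < num_periods E"
  using valid by (auto simp: valid_ev_model_def next_period_def)

lemma expectation_cost:
  fixes f :: "real \<Rightarrow> real"
  assumes "c \<in> costs E"
  shows "measure_pmf.expectation (cost_trans E c) f = (\<Sum>x\<in>costs E. f x * pmf (cost_trans E c) x)"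
  using cost_trans_closed[OF assms] finite_costs by (intro integral_measure_pmf_real) auto

lemma finite_ext_space: "finite (ext_space E i)"
  using finite_costs by (auto simp: ext_space_def arm_space_def)

lemma arm_trans_closed:
  assumes "S \<in> arm_space E i" "\<tau> < num_periods E"
  shows "set_pmf (arm_trans E i \<tau> a S) \<subseteq> arm_space E i"
proof -
  have "set_pmf (arr_dist E i \<tau>) \<subseteq> {1..max_lead E} \<times> {1..max_demand E}" if "i \<in> regular E"
    using valid that assms(2) by (auto simp: valid_ev_model_def regular_def)
  then show ?thesis
    using assms(1) by (fastforce simp: arm_trans_def arm_space_def split: prod.splits if_splits)
qed

lemma ext_trans_closed:
  assumes "s \<in> ext_space E i"
  shows "set_pmf (ext_trans E i s a) \<subseteq> ext_space E i"
  using assms arm_trans_closed cost_trans_closed next_period_less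
  by (fastforce simp: ext_space_def ext_trans_def)

sublocale subsidy: finite_discounted_mdp
  "disc E" "ext_trans E i" "subsidy_reward E i \<nu>" "\<lambda>_. {0, 1}" "ext_space E i" for i \<nu>
  using discount finite_ext_space ext_trans_closed by unfold_locales auto

lemma subsidy_value_bellman:
  assumes "s \<in> ext_space E i"
  shows "subsidy_value E i \<nu> s = max (net_value E i \<nu> 0 s + \<nu>) (net_value E i \<nu> 1 s)"
proof -
  have "subsidy.q_value i \<nu> (subsidy_value E i \<nu>) s a = net_value E i \<nu> a s + (if a = 0 then \<nu> else 0)"
    for a
    by (simp add: subsidy.q_value_def net_value_def subsidy_reward_def expected_next_def)
  then show ?thesis
    using subsidy.bellman_equation[OF _ assms, of \<nu>] by (simp add: subsidy_value_def)
qed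

text \<open>
  Charging one unit now leads to the same continuation as having had one unit less to charge and
  staying passive, up to the net price \<open>1 - c\<close> earned for the unit. At the deadline this identity
  also needs that no penalty is due when no demand is left.
\<close>

lemma net_value_active:
  assumes "i \<in> regular E" "0 < T" "0 < B"
  shows "net_value E i \<nu> 1 ((T, B), c, \<tau>) = 1 - c + net_value E i \<nu> 0 ((T, B - 1), c, \<tau>)"
  using assms penalty_zero
  by (cases "T = 1"; cases "B = 1")
     (auto simp: net_value_def reward_def expected_next_def ext_trans_def arm_trans_def)

lemma net_value_no_demand:
  "net_value E i \<nu> 1 ((T, 0), c, \<tau>) = net_value E i \<nu> 0 ((T, 0), c, \<tau>)"
  by (simp add: net_value_def reward_def expected_next_def ext_trans_def arm_trans_def)

lemma net_value_passive:
  assumes "i \<in> regular E"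
  shows "net_value E i \<nu> 0 ((Suc (Suc n), B), c, \<tau>) =
    disc E * measure_pmf.expectation (cost_trans E c)
      (\<lambda>c'. subsidy_value E i \<nu> ((Suc n, B), c', next_period E \<tau>))"
  using assms
  by (cases "B = 0") (simp_all add: net_value_def reward_def expected_next_def ext_trans_def
      arm_trans_def pair_return_pmf1 map_pmf_comp)

text \<open>
  Subtracting the Bellman equations at demands \<open>b\<close> and \<open>b + 1\<close> eliminates the passive
  continuations; what remains involves only advantages of the active
  action one period closer to the deadline. In particular arrivals and the period drop out.
\<close>

lemma net_value_difference:
  assumes "i \<in> regular E"
  shows "(Suc n, B) \<in> arm_space E i \<Longrightarrow> c \<in> costs E \<Longrightarrow> \<tau> < num_periods E \<Longrightarrow>
    net_value E i \<nu> 1 ((Suc n, B), c, \<tau>) - net_value E i \<nu> 0 ((Suc n, B), c, \<tau>) =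
    activation_gain E \<nu> n B c"
proof (induction n arbitrary: B c \<tau>)
  case 0
  then show ?case
    using assms
    by (cases B)
       (auto simp: net_value_def reward_def expected_next_def ext_trans_def arm_trans_def)
next
  case (Suc n)
  show ?case
  proof (cases B)
    case 0
    then show ?thesis by (simp add: net_value_no_demand del: One_nat_def)
  next
    case (Suc b)
    let ?p = "cost_trans E c" and ?\<tau> = "next_period E \<tau>"
    let ?v = "\<lambda>B c'. subsidy_value E i \<nu> ((Suc n, B), c', ?\<tau>)"
    have spaces: "(Suc n, b) \<in> arm_space E i" "(Suc n, Suc b) \<in> arm_space E i"
      using Suc.prems(1) assms Suc by (auto simp: arm_space_def)
    have step: "?v b c' - ?v (Suc b) c' = max \<nu> (activation_gain E \<nu> n b c') - (1 - c')
        + min (activation_gain E \<nu> n (Suc b) c' - \<nu>) 0" if "c' \<in> costs E" for c'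
    proof -
      have "?v B c' = net_value E i \<nu> 0 ((Suc n, B), c', ?\<tau>) + max \<nu> (activation_gain E \<nu> n B c')"
        if "(Suc n, B) \<in> arm_space E i" for B
        using Suc.IH[OF that \<open>c' \<in> costs E\<close> next_period_less[of \<tau>]] that \<open>c' \<in> costs E\<close> next_period_less[of \<tau>]
          subsidy_value_bellman[of "((Suc n, B), c', ?\<tau>)" i \<nu>]
        by (simp add: ext_space_def max_def)
      moreover have "net_value E i \<nu> 0 ((Suc n, b), c', ?\<tau>) - net_value E i \<nu> 0 ((Suc n, Suc b), c', ?\<tau>)
          = activation_gain E \<nu> n (Suc b) c' - (1 - c')"
        using Suc.IH[OF spaces(2) that next_period_less[of \<tau>]]
          net_value_active[OF assms, of "Suc n" "Suc b" \<nu> c' ?\<tau>] by simp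
      ultimately show ?thesis
        using spaces by (simp add: max_def min_def)
    qed
    have fin: "finite (set_pmf ?p)"
      using cost_trans_closed[OF Suc.prems(2)] finite_costs finite_subset by blast
    have "net_value E i \<nu> 1 ((Suc (Suc n), B), c, \<tau>) - net_value E i \<nu> 0 ((Suc (Suc n), B), c, \<tau>)
        = 1 - c + disc E * (measure_pmf.expectation ?p (?v b) - measure_pmf.expectation ?p (?v (Suc b)))"
      using net_value_active[OF assms, of "Suc (Suc n)" B \<nu> c \<tau>] Suc assms
      by (simp add: net_value_passive right_diff_distrib)
    also have "measure_pmf.expectation ?p (?v b) - measure_pmf.expectation ?p (?v (Suc b)) =
        measure_pmf.expectation ?p (\<lambda>c'. ?v b c' - ?v (Suc b) c')"
      by (simp add: integrable_measure_pmf_finite[OF fin])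
    also have "\<dots> = measure_pmf.expectation ?p (\<lambda>c'. max \<nu> (activation_gain E \<nu> n b c') - (1 - c')
        + min (activation_gain E \<nu> n (Suc b) c' - \<nu>) 0)"
      using cost_trans_closed[OF Suc.prems(2)] step by (intro expectation_cong_pmf) auto
    finally show ?thesis using Suc by simp
  qed
qed

text \<open>
  A charger without a vehicle, in particular a dummy charger, has no demand and gain \<open>0\<close>, so that
  the truncated subtraction at \<open>T = 0\<close> is harmless.
\<close>

lemma net_value_gain:
  assumes "((T, B), c, \<tau>) \<in> ext_space E i"
  shows "net_value E i \<nu> 1 ((T, B), c, \<tau>) =
    net_value E i \<nu> 0 ((T, B), c, \<tau>) + activation_gain E \<nu> (T - 1) B c"
proof (cases "B = 0")
  case True
  then show ?thesis by (simp add: net_value_no_demand del: One_nat_def)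
next
  case False
  then have "i \<in> regular E" "T = Suc (T - 1)"
    using assms by (auto simp: ext_space_def arm_space_def split: if_splits)
  then show ?thesis
    using net_value_difference[of i "T - 1" B c \<tau> \<nu>] assms by (auto simp: ext_space_def)
qed


section \<open>Indexability\<close>

text \<open>
  The gain grows at most at rate \<open>disc E < 1\<close> in the subsidy: the expression under the expectation
  is increasing in both gains, and raising these and \<open>\<nu>\<close> all by \<open>h\<close> raises it by exactly \<open>h\<close>.
\<close>

lemma activation_gain_increase:
  assumes "\<nu> \<le> \<nu>'"
  shows "c \<in> costs E \<Longrightarrow> activation_gain E \<nu>' n B c \<le> activation_gain E \<nu> n B c + disc E * (\<nu>' - \<nu>)"
proof (induction n arbitrary: B c)
  case 0
  then show ?case using assms discount by (cases B) auto
next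
  case (Suc n)
  let ?g = "\<lambda>\<nu> b c'. max \<nu> (activation_gain E \<nu> n b c') - (1 - c')
    + min (activation_gain E \<nu> n (Suc b) c' - \<nu>) 0"
  let ?h = "\<nu>' - \<nu>"
  show ?case
  proof (cases B)
    case 0
    then show ?thesis using assms discount by simp
  next
    case (Suc b)
    have le: "activation_gain E \<nu>' n B c' \<le> activation_gain E \<nu> n B c' + ?h" if "c' \<in> costs E" for B c'
    proof -
      have "disc E * ?h \<le> 1 * ?h" using assms discount by (intro mult_right_mono) auto
      then show ?thesis using Suc.IH[OF that, of B] by simp
    qed
    have pointwise: "?g \<nu>' b c' \<le> ?g \<nu> b c' + ?h" if "c' \<in> costs E" for c'
      using le[OF that, of b] le[OF that, of "Suc b"] by (simp add: max_def min_def)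
    have "measure_pmf.expectation (cost_trans E c) (?g \<nu>' b)
        \<le> measure_pmf.expectation (cost_trans E c) (\<lambda>c'. ?g \<nu> b c' + ?h)"
      unfolding expectation_cost[OF Suc.prems]
      using pointwise by (intro sum_mono mult_right_mono) auto
    also have "\<dots> = measure_pmf.expectation (cost_trans E c) (?g \<nu> b) + ?h"
    proof -
      have "finite (set_pmf (cost_trans E c))"
        using cost_trans_closed[OF Suc.prems] finite_costs finite_subset by blast
      then show ?thesis
        by (subst Bochner_Integration.integral_add)
           (auto intro: integrable_measure_pmf_finite)
    qed
    finally show ?thesis
      using discount Suc by (simp flip: distrib_left add: add.assoc)
  qed
qed

lemma activation_gain_continuous:
  "c \<in> costs E \<Longrightarrow> continuous_on UNIV (\<lambda>\<nu>. activation_gain E \<nu> n B c)"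
proof (induction n arbitrary: B c)
  case 0
  then show ?case by (cases B) auto
next
  case (Suc n)
  then show ?case
    by (cases B) (auto simp: expectation_cost intro!: continuous_intros)
qed

text \<open>
  The form in which the growth bound is used: \<open>\<nu> - g \<nu>\<close> is strictly increasing and unbounded in both
  directions, whence the gain has a unique fixed point.
\<close>

lemma activation_gain_surplus:
  assumes "\<nu> \<le> \<nu>'" "c \<in> costs E"
  shows "\<nu> - activation_gain E \<nu> n B c + (1 - disc E) * (\<nu>' - \<nu>) \<le> \<nu>' - activation_gain E \<nu>' n B c"
  using activation_gain_increase[OF assms, of n B] by (simp add: algebra_simps)

lemma activation_gain_fixed_point_exists:
  assumes "c \<in> costs E"
  shows "\<exists>x. activation_gain E x n B c = x"
proof -
  define h where "h \<nu> = \<nu> - activation_gain E \<nu> n B c" for \<nu>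
  \<comment> \<open>growing at rate at least \<open>1 - disc E\<close>, \<open>h\<close> makes up for \<open>h 0\<close> within distance \<open>d\<close>\<close>
  define d where "d = \<bar>h 0\<bar> / (1 - disc E)"
  have d: "0 \<le> d" "(1 - disc E) * d = \<bar>h 0\<bar>"
    using discount by (auto simp: d_def)
  have "h (- d) \<le> 0" "0 \<le> h d"
    using activation_gain_surplus[of "- d" 0 c n B] activation_gain_surplus[of 0 d c n B] assms d
    by (auto simp: h_def)
  moreover have "continuous_on {- d..d} h"
    unfolding h_def using activation_gain_continuous[OF assms]
    by (intro continuous_intros) (rule continuous_on_subset, auto)
  ultimately obtain x where "h x = 0"
    using IVT'[of h "- d" 0 d] d by auto
  then have "activation_gain E x n B c = x" by (simp add: h_def)
  then show ?thesis ..
qed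

lemma activation_gain_le_iff:
  assumes "activation_gain E x n B c = x" "c \<in> costs E"
  shows "activation_gain E \<nu> n B c \<le> \<nu> \<longleftrightarrow> x \<le> \<nu>"
    and "\<nu> \<le> activation_gain E \<nu> n B c \<longleftrightarrow> \<nu> \<le> x"
proof -
  have pos: "0 < (1 - disc E) * (y - z)" if "z < y" for y z
    using that discount by simp
  show "activation_gain E \<nu> n B c \<le> \<nu> \<longleftrightarrow> x \<le> \<nu>" and "\<nu> \<le> activation_gain E \<nu> n B c \<longleftrightarrow> \<nu> \<le> x"
    using activation_gain_surplus[of \<nu> x c n B] activation_gain_surplus[of x \<nu> c n B]
      pos[of \<nu> x] pos[of x \<nu>] assms
    by (cases \<nu> x rule: linorder_cases; simp)+
qed

lemma whittle_index_eq_fixed_point: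
  assumes "((T, B), c, \<tau>) \<in> ext_space E i" "activation_gain E x (T - 1) B c = x"
  shows "whittle_index E i ((T, B), c, \<tau>) = x"
proof -
  have "c \<in> costs E" using assms(1) by (simp add: ext_space_def)
  then have "{\<nu>. passive_optimal E i \<nu> ((T, B), c, \<tau>)} = {x..}"
    using net_value_gain[OF assms(1)] activation_gain_le_iff(1)[OF assms(2)]
    by (auto simp: passive_optimal_net_value)
  then show ?thesis by (simp add: whittle_index_def)
qed

lemma whittle_index_fixed_point:
  assumes "((T, B), c, \<tau>) \<in> ext_space E i"
  shows "activation_gain E (whittle_index E i ((T, B), c, \<tau>)) (T - 1) B c =
    whittle_index E i ((T, B), c, \<tau>)"
  using activation_gain_fixed_point_exists[of c "T - 1" B] whittle_index_eq_fixed_point[OF assms] assms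
  by (auto simp: ext_space_def)

text \<open>
  Uniqueness of the fixed point gives both comparisons with the index, weakly. At the index itself
  both actions are optimal, which is what makes any breaking of ties harmless.
\<close>

lemma passive_optimal_iff_index_le:
  assumes "s \<in> ext_space E i"
  shows "net_value E i \<nu> 1 s \<le> net_value E i \<nu> 0 s + \<nu> \<longleftrightarrow> whittle_index E i s \<le> \<nu>"
proof -
  obtain T B c \<tau> where [simp]: "s = ((T, B), c, \<tau>)" by (metis surj_pair)
  show ?thesis
    using net_value_gain activation_gain_le_iff(1)[OF whittle_index_fixed_point] assms
    by (fastforce simp: ext_space_def)
qed

lemma active_optimal_iff_index_ge:
  assumes "s \<in> ext_space E i"
  shows "net_value E i \<nu> 0 s + \<nu> \<le> net_value E i \<nu> 1 s \<longleftrightarrow> \<nu> \<le> whittle_index E i s"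
proof -
  obtain T B c \<tau> where [simp]: "s = ((T, B), c, \<tau>)" by (metis surj_pair)
  show ?thesis
    using net_value_gain activation_gain_le_iff(2)[OF whittle_index_fixed_point] assms
    by (fastforce simp: ext_space_def)
qed

theorem indexable_charger: "indexable E i"
proof -
  have index_le: "passive_set E i \<nu> = {s \<in> ext_space E i. whittle_index E i s \<le> \<nu>}" for \<nu>
    using passive_optimal_iff_index_le by (auto simp: passive_set_def passive_optimal_net_value)
  have "\<forall>\<^sub>F \<nu> in at_bot. \<forall>s\<in>ext_space E i. \<nu> < whittle_index E i s"
    using finite_ext_space by (intro eventually_ball_finite ballI eventually_gt_at_bot)
  then have "\<forall>\<^sub>F \<nu> in at_bot. passive_set E i \<nu> = {}"
    by eventually_elim (auto simp: index_le)
  moreover have "\<forall>\<^sub>F \<nu> in at_top. \<forall>s\<in>ext_space E i. whittle_index E i s \<le> \<nu>"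
    using finite_ext_space by (intro eventually_ball_finite ballI eventually_ge_at_top)
  then have "\<forall>\<^sub>F \<nu> in at_top. passive_set E i \<nu> = ext_space E i"
    by eventually_elim (auto simp: index_le)
  ultimately show ?thesis
    by (auto simp: indexable_def index_le mono_def)
qed

end

section \<open>Optimality of the index policy for as many dummies as regular chargers\<close>

text \<open>
  A negative value before the cut would push all of \<open>Z\<close> before the cut, where not all of it fits
  beside the negative entry; a positive value after the cut would push all of \<open>Z\<close> after it.
\<close>

lemma sign_of_sorted_list_parts:
  fixes f :: "'a \<Rightarrow> real"
  assumes "sorted_wrt (\<lambda>i j. f j \<le> f i) xs" "Z \<subseteq> set xs" "\<And>z. z \<in> Z \<Longrightarrow> f z = 0"
    and "m \<le> card Z" "length xs - m \<le> card Z"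
  shows "i \<in> set (take m xs) \<Longrightarrow> 0 \<le> f i" and "i \<in> set (drop m xs) \<Longrightarrow> f i \<le> 0"
proof -
  have "sorted_wrt (\<lambda>i j. f j \<le> f i) (take m xs @ drop m xs)"
    using assms(1) by simp
  then have order: "f j \<le> f i" if "i \<in> set (take m xs)" "j \<in> set (drop m xs)" for i j
    unfolding sorted_wrt_append using that by blast
  have parts: "z \<in> set (take m xs) \<or> z \<in> set (drop m xs)" if "z \<in> Z" for z
    using that assms(2) by (metis UnE append_take_drop_id set_append subsetD)
  have no_room: "\<not> Z \<subseteq> set ys - {i}" if "i \<in> set ys" "length ys \<le> card Z" for ys
  proof
    assume "Z \<subseteq> set ys - {i}"
    then have "card Z \<le> card (set ys - {i})" by (intro card_mono) auto
    also have "\<dots> < card (set ys)" using that(1) by (intro card_Diff1_less) auto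
    also have "\<dots> \<le> length ys" by (rule card_length)
    finally show False using that(2) by simp
  qed
  show "0 \<le> f i" if i: "i \<in> set (take m xs)"
  proof (rule ccontr)
    assume "\<not> 0 \<le> f i"
    then have "Z \<subseteq> set (take m xs) - {i}"
      using order[OF i] assms(3) parts by fastforce
    then show False using no_room[OF i] assms(4) by simp
  qed
  show "f i \<le> 0" if i: "i \<in> set (drop m xs)"
  proof (rule ccontr)
    assume "\<not> f i \<le> 0"
    then have "Z \<subseteq> set (drop m xs) - {i}"
      using order[OF _ i] assms(3) parts by fastforce
    then show False using no_room[OF i] assms(5) by simp
  qed
qed

context ev_charging
begin

lemma finite_arms: "finite (arms E)"
  by (simp add: arms_def)

lemma mab_space_component:
  assumes "(S, c, \<tau>) \<in> mab_space E" "i \<in> arms E"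
  shows "(S i, c, \<tau>) \<in> ext_space E i"
  using assms by (auto simp: mab_space_def ext_space_def PiE_dflt_def)

lemma finite_mab_space: "finite (mab_space E)"
proof -
  have "finite (PiE_dflt (arms E) (0, 0) (arm_space E))"
    using finite_arms by (intro finite_PiE_dflt) (auto simp: arm_space_def)
  then show ?thesis using finite_costs by (simp add: mab_space_def)
qed

lemma finite_mab_actions: "finite (mab_actions E)"
proof -
  have "finite (PiE (arms E) (\<lambda>_. {0, 1 :: nat}))"
    using finite_arms by (intro finite_PiE) auto
  then show ?thesis by (auto simp: mab_actions_def)
qed

lemma mab_trans_closed:
  assumes "s \<in> mab_space E"
  shows "set_pmf (mab_trans E s a) \<subseteq> mab_space E"
proof -
  obtain S c \<tau> where s: "s = (S, c, \<tau>)" by (metis surj_pair)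
  have S: "S i \<in> arm_space E i" if "i \<in> arms E" for i
    using assms that by (auto simp: s mab_space_def PiE_dflt_def)
  have "c \<in> costs E" "\<tau> < num_periods E"
    using assms by (auto simp: s mab_space_def)
  moreover have "PiE_dflt (arms E) (0, 0) (set_pmf \<circ> (\<lambda>i. arm_trans E i \<tau> (a i) (S i)))
      \<subseteq> PiE_dflt (arms E) (0, 0) (arm_space E)"
    using arm_trans_closed[OF S \<open>\<tau> < num_periods E\<close>] by (fastforce simp: PiE_dflt_def)
  ultimately show ?thesis
    using finite_arms cost_trans_closed[of c] next_period_less
    by (fastforce simp: s mab_trans_def mab_space_def set_Pi_pmf)
qed

sublocale mab: finite_discounted_mdp
  "disc E" "mab_trans E" "mab_reward E" "\<lambda>_. mab_actions E" "mab_space E"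
  using discount finite_mab_space finite_mab_actions mab_trans_closed by unfold_locales auto

lemma mab_trans_component:
  assumes "i \<in> arms E"
  shows "map_pmf (\<lambda>(S', c', \<tau>'). (S' i, c', \<tau>')) (mab_trans E (S, c, \<tau>) a) =
    ext_trans E i (S i, c, \<tau>) (a i)"
proof -
  let ?q = "Pi_pmf (arms E) (0, 0) (\<lambda>i. arm_trans E i \<tau> (a i) (S i))"
  have "pair_pmf (arm_trans E i \<tau> (a i) (S i)) (cost_trans E c) =
      pair_pmf (map_pmf (\<lambda>S'. S' i) ?q) (map_pmf (\<lambda>c'. c') (cost_trans E c))"
    using assms finite_arms by (simp add: Pi_pmf_component)
  also have "\<dots> = map_pmf (\<lambda>(S', c'). (S' i, c')) (pair_pmf ?q (cost_trans E c))"
    by (rule map_pair[symmetric])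
  finally show ?thesis
    by (simp add: mab_trans_def ext_trans_def map_pmf_comp split_def)
qed

definition decoupled_value :: "mab_state \<Rightarrow> real" where
  "decoupled_value = (\<lambda>(S, c, \<tau>). \<Sum>i\<in>arms E. subsidy_value E i 0 (S i, c, \<tau>))"

text \<open>
  Although the chargers share the cost and the period and are thus dependent, linearity of
  expectation needs only the marginal law of each charger, which is that of the charger alone.
\<close>

lemma mab_q_value_decoupled:
  assumes "(S, c, \<tau>) \<in> mab_space E"
  shows "mab.q_value decoupled_value (S, c, \<tau>) a = (\<Sum>i\<in>arms E. net_value E i 0 (a i) (S i, c, \<tau>))"
proof -
  have fin: "finite (set_pmf (mab_trans E (S, c, \<tau>) a))"
    using mab_trans_closed[OF assms] finite_mab_space finite_subset by blast
  have "measure_pmf.expectation (mab_trans E (S, c, \<tau>) a) decoupled_value =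
      (\<Sum>i\<in>arms E. measure_pmf.expectation (mab_trans E (S, c, \<tau>) a)
        (\<lambda>(S', c', \<tau>'). subsidy_value E i 0 (S' i, c', \<tau>')))"
    unfolding decoupled_value_def split_def
    by (intro Bochner_Integration.integral_sum integrable_measure_pmf_finite fin)
  also have "\<dots> = (\<Sum>i\<in>arms E. expected_next E i (a i) (subsidy_value E i 0) (S i, c, \<tau>))"
    by (intro sum.cong refl)
       (simp add: expected_next_def split_def flip: mab_trans_component)
  finally show ?thesis
    unfolding mab.q_value_def by (simp add: mab_reward_def net_value_def sum.distrib sum_distrib_left)
qed

lemma whittle_index_dummy:
  assumes "i \<in> dummy E" "(S, c, \<tau>) \<in> ext_space E i"
  shows "whittle_index E i (S, c, \<tau>) = 0"
proof -
  have "S = (0, 0)"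
    using assms by (auto simp: dummy_def regular_def ext_space_def arm_space_def)
  then show ?thesis
    using assms by (auto intro: whittle_index_eq_fixed_point)
qed

text \<open>
  With \<open>M = N\<close>, the \<open>M\<close> dummies of index zero are as many as the activated and as the passive
  chargers, so that the cut of the sorted list separates nonnegative from nonpositive indices.
\<close>

lemma whittle_action_net_value:
  assumes "num_active E = num_regular E" "(S, c, \<tau>) \<in> mab_space E"
    and "a \<in> whittle_actions E (S, c, \<tau>)" "i \<in> arms E"
  shows "net_value E i 0 (a i) (S i, c, \<tau>) = subsidy_value E i 0 (S i, c, \<tau>)"
proof -
  let ?w = "\<lambda>i. whittle_index E i (S i, c, \<tau>)"
  note ext = mab_space_component[OF assms(2)]
  obtain xs where xs: "distinct xs" "set xs = arms E" "sorted_wrt (\<lambda>i j. ?w j \<le> ?w i) xs"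
    "{i \<in> arms E. a i = 1} = set (take (num_active E) xs)"
    using assms(3) by (auto simp: whittle_actions_def)
  have "a i \<in> {0, 1}"
    using assms(3,4) by (auto simp: whittle_actions_def mab_actions_def PiE_def Pi_def)
  have len: "length xs = 2 * num_active E"
    using distinct_card[OF xs(1)] xs(2) assms(1) by (simp add: arms_def)
  have dummies: "dummy E \<subseteq> set xs" "\<And>z. z \<in> dummy E \<Longrightarrow> ?w z = 0" "card (dummy E) = num_active E"
    using xs(2) ext by (auto simp: dummy_def arms_def intro!: whittle_index_dummy)
  have cut: "j \<in> set (take (num_active E) xs) \<Longrightarrow> 0 \<le> ?w j" "j \<in> set (drop (num_active E) xs) \<Longrightarrow> ?w j \<le> 0"
    for j
    using sign_of_sorted_list_parts[OF xs(3) dummies(1,2), of "num_active E" j] dummies(3) len by auto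
  show ?thesis
  proof (cases "a i = 1")
    case True
    then have "0 \<le> ?w i" using cut(1) xs(4) assms(4) by blast
    then show ?thesis
      using True active_optimal_iff_index_ge[OF ext, of i 0] subsidy_value_bellman[OF ext, of i 0] assms(4)
      by simp
  next
    case False
    have "i \<in> set (take (num_active E) xs) \<union> set (drop (num_active E) xs)"
      using assms(4) xs(2) by (metis append_take_drop_id set_append)
    then have "?w i \<le> 0" using False cut(2) xs(4) by blast
    then show ?thesis
      using False \<open>a i \<in> {0, 1}\<close> passive_optimal_iff_index_le[OF ext, of i 0]
        subsidy_value_bellman[OF ext, of i 0] assms(4)
      by simp
  qed
qed

theorem whittle_policy_optimal:
  assumes "num_active E = num_regular E" "whittle_policy E \<pi>" "s0 \<in> mab_space E"
  shows "mab_optimal E \<pi> s0"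
proof -
  have \<pi>: "\<pi> \<in> policies (\<lambda>_. mab_actions E)"
    using assms(2) by (simp add: whittle_policy_def)
  have "policy_value (disc E) (mab_trans E) (mab_reward E) \<pi>' s0 \<le> decoupled_value s0"
    if "\<pi>' \<in> policies (\<lambda>_. mab_actions E)" for \<pi>'
  proof (rule mab.policy_value_le[OF that assms(3)])
    fix s a assume s: "s \<in> mab_space E" and a: "a \<in> mab_actions E"
    obtain S c \<tau> where [simp]: "s = (S, c, \<tau>)" by (metis surj_pair)
    have "net_value E i 0 (a i) (S i, c, \<tau>) \<le> subsidy_value E i 0 (S i, c, \<tau>)" if "i \<in> arms E" for i
    proof -
      have "a i = 0 \<or> a i = 1" using a that by (auto simp: mab_actions_def PiE_def Pi_def)
      then show ?thesis
        using subsidy_value_bellman[OF mab_space_component, of S c \<tau> i 0] s that by auto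
    qed
    then show "mab.q_value decoupled_value s a \<le> decoupled_value s"
      using s by (simp add: mab_q_value_decoupled) (simp add: decoupled_value_def sum_mono)
  qed
  moreover have "policy_value (disc E) (mab_trans E) (mab_reward E) \<pi> s0 = decoupled_value s0"
  proof (rule mab.policy_value_eq[OF \<pi> assms(3)])
    fix h s a assume s: "s \<in> mab_space E" and a: "a \<in> set_pmf (\<pi> h s)"
    obtain S c \<tau> where [simp]: "s = (S, c, \<tau>)" by (metis surj_pair)
    have "a \<in> whittle_actions E s"
      using assms(2) s a by (auto simp: whittle_policy_def)
    then show "mab.q_value decoupled_value s a = decoupled_value s"
      using s whittle_action_net_value[OF assms(1)]
      by (simp add: mab_q_value_decoupled) (simp add: decoupled_value_def)
  qed
  ultimately show ?thesis
    using \<pi> by (auto simp: mab_optimal_def optimal_policy_from_def)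
qed


section \<open>The index under a constant charging cost\<close>

lemma penalty_increment_mono:
  assumes "0 < j" "j \<le> k"
  shows "penalty E (real j) - penalty E (real (j - 1)) \<le> penalty E (real k) - penalty E (real (k - 1))"
  using assms(2)
proof (induction k rule: dec_induct)
  case (step k)
  have "convex_on {0..} (penalty E)"
    using valid by (simp add: valid_ev_model_def)
  then have "penalty E ((1 - 1/2) *\<^sub>R real (k - 1) + (1/2) *\<^sub>R real (Suc k))
      \<le> (1 - 1/2) * penalty E (real (k - 1)) + (1/2) * penalty E (real (Suc k))"
    by (rule convex_onD) auto
  moreover have "(1 - 1/2) *\<^sub>R real (k - 1) + (1/2) *\<^sub>R real (Suc k) = real k"
    using step assms(1) by (simp add: of_nat_diff field_simps)
  ultimately show ?case using step.IH by simp
qed simp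

lemma penalty_increment_nonneg:
  "0 \<le> penalty E (real k) - penalty E (real (k - 1))"
  using valid by (auto simp: valid_ev_model_def dest!: mono_onD[of _ _ "real (k - 1)" "real k"])

lemma activation_gain_constant_cost:
  assumes "cost_trans E c = return_pmf c"
  shows "activation_gain E \<nu> (Suc n) (Suc b) c = 1 - c + disc E *
    (max \<nu> (activation_gain E \<nu> n b c) - (1 - c) + min (activation_gain E \<nu> n (Suc b) c - \<nu>) 0)"
  by (simp add: assms)

text \<open>
  With \<open>B \<le> n\<close>, a unit left uncharged now can still be charged before the deadline, and at subsidy
  \<open>1 - c\<close> it does not matter when. The recursion for demand \<open>1\<close> involves the gain \<open>0\<close> at demand \<open>0\<close>;
  its maximum with the subsidy is the subsidy because \<open>c \<le> 1\<close>. The auxiliary bound \<open>ge\<close> serves the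
  boundary \<open>B = n\<close>, where the recursion refers to a demand that no longer has slack.
\<close>

lemma activation_gain_slack:
  assumes const: "cost_trans E c = return_pmf c" and "c \<le> 1"
  shows "0 < B \<Longrightarrow> B \<le> n \<Longrightarrow> activation_gain E (1 - c) n B c = 1 - c"
proof -
  have ge: "0 < B \<Longrightarrow> 1 - c \<le> activation_gain E (1 - c) n B c" for n B
  proof (induction n arbitrary: B)
    case 0
    then show ?case using penalty_increment_nonneg[of B] by (cases B) auto
  next
    case (Suc n)
    then obtain b where B: "B = Suc b" by (cases B) auto
    show ?case
      unfolding B activation_gain_constant_cost[OF const]
      using Suc.IH[of "Suc b"] discount by simp
  qed
  show "0 < B \<Longrightarrow> B \<le> n \<Longrightarrow> activation_gain E (1 - c) n B c = 1 - c"
  proof (induction n arbitrary: B)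
    case (Suc n)
    then obtain b where B: "B = Suc b" by (cases B) auto
    have "max (1 - c) (activation_gain E (1 - c) n b c) = 1 - c"
      using Suc.IH[of b] Suc.prems \<open>c \<le> 1\<close> B by (cases "b = 0") auto
    then show ?case
      unfolding B activation_gain_constant_cost[OF const] using ge[of "Suc b" n] by simp
  qed simp
qed

text \<open>
  With \<open>B > n\<close>, at most \<open>n\<close> units can be charged after the present period, so activation saves the
  penalty increment from \<open>B - n - 1\<close> to \<open>B - n\<close> at the deadline, \<open>n\<close> periods later, if the charger
  stays active until then. It does so below the stated bound on the subsidy. The bound tightens as
  \<open>n\<close> grows for fixed \<open>B - n\<close> and, by convexity, relaxes as \<open>B\<close> grows, so it passes to both gains in
  the recursion.
\<close>

lemma activation_gain_tight:
  assumes const: "cost_trans E c = return_pmf c"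
  defines "f \<equiv> \<lambda>k. penalty E (real k) - penalty E (real (k - 1))"
  shows "n < B \<Longrightarrow> \<nu> \<le> 1 - c + disc E ^ n * f (B - n) \<Longrightarrow>
    activation_gain E \<nu> n B c = 1 - c + disc E ^ n * f (B - n)"
proof (induction n arbitrary: B)
  case 0
  then show ?case by (cases B) (auto simp: f_def)
next
  case (Suc n)
  then obtain b where B: "B = Suc b" "n < b" by (cases B) auto
  have "0 \<le> f (b - n)"
    unfolding f_def by (rule penalty_increment_nonneg)
  then have "disc E ^ Suc n * f (b - n) \<le> disc E ^ n * f (b - n)"
    using discount by (intro mult_right_mono power_decreasing) auto
  moreover have "disc E ^ n * f (b - n) \<le> disc E ^ n * f (Suc b - n)"
    unfolding f_def using B discount by (intro mult_left_mono penalty_increment_mono) auto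
  moreover have "\<nu> \<le> 1 - c + disc E ^ Suc n * f (b - n)"
    using Suc.prems B by simp
  ultimately have le: "\<nu> \<le> 1 - c + disc E ^ n * f (b - n)" "\<nu> \<le> 1 - c + disc E ^ n * f (Suc b - n)"
    by linarith+
  have "activation_gain E \<nu> n b c = 1 - c + disc E ^ n * f (b - n)"
    "activation_gain E \<nu> n (Suc b) c = 1 - c + disc E ^ n * f (Suc b - n)"
    using Suc.IH[of b] Suc.IH[of "Suc b"] B le by auto
  then show ?case
    unfolding B activation_gain_constant_cost[OF const] using le by simp
qed

theorem whittle_index_constant_cost:
  assumes const: "cost_trans E c = return_pmf c" and s: "((T, B), c, \<tau>) \<in> ext_space E i"
  shows "B = 0 \<Longrightarrow> whittle_index E i ((T, B), c, \<tau>) = 0"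
    and "1 \<le> B \<Longrightarrow> B \<le> T - 1 \<Longrightarrow> c \<le> 1 \<Longrightarrow> whittle_index E i ((T, B), c, \<tau>) = 1 - c"
    and "1 \<le> B \<Longrightarrow> T \<le> B \<Longrightarrow> whittle_index E i ((T, B), c, \<tau>) =
      1 - c + disc E ^ (T - 1) * (penalty E (real (B - T + 1)) - penalty E (real (B - T)))"
proof -
  note index_eq = whittle_index_eq_fixed_point[OF s]
  show "B = 0 \<Longrightarrow> whittle_index E i ((T, B), c, \<tau>) = 0"
    by (rule index_eq) simp
  show "1 \<le> B \<Longrightarrow> B \<le> T - 1 \<Longrightarrow> c \<le> 1 \<Longrightarrow> whittle_index E i ((T, B), c, \<tau>) = 1 - c"
    by (rule index_eq) (simp add: activation_gain_slack[OF const])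
  assume "1 \<le> B" "T \<le> B"
  then have "0 < T"
    using s by (auto simp: ext_space_def arm_space_def split: if_splits)
  then have "B - (T - 1) = B - T + 1" "T - 1 < B" using \<open>T \<le> B\<close> by auto
  then show "whittle_index E i ((T, B), c, \<tau>) =
      1 - c + disc E ^ (T - 1) * (penalty E (real (B - T + 1)) - penalty E (real (B - T)))"
    using activation_gain_tight[OF const, of "T - 1" B] by (intro index_eq) simp
qed

end

theorem theorem1:
  fixes E :: ev_model
  assumes "valid_ev_model E"
  shows "((\<forall>i\<in>arms E. indexable E i) \<and> mab_indexable E) \<and>
    (num_active E = num_regular E \<longrightarrow>
       (\<forall>\<pi> s0. whittle_policy E \<pi> \<longrightarrow> s0 \<in> mab_space E \<longrightarrow> mab_optimal E \<pi> s0)) \<and>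
    (\<forall>c0\<in>costs E. cost_trans E c0 = return_pmf c0 \<longrightarrow>
       (\<forall>i\<in>regular E. \<forall>T B. \<forall>\<tau><num_periods E. (T, B) \<in> arm_space E i \<longrightarrow>
          (B = 0 \<longrightarrow> whittle_index E i ((T, B), c0, \<tau>) = 0) \<and>
          (1 \<le> B \<and> B \<le> T - 1 \<and> c0 \<le> 1 \<longrightarrow> whittle_index E i ((T, B), c0, \<tau>) = 1 - c0) \<and>
          (1 \<le> B \<and> T \<le> B \<longrightarrow> whittle_index E i ((T, B), c0, \<tau>) =
             1 - c0 + disc E ^ (T - 1) *
               (penalty E (real (B - T + 1)) - penalty E (real (B - T))))) \<and>
       (\<forall>i\<in>dummy E. \<forall>\<tau><num_periods E. whittle_index E i ((0, 0), c0, \<tau>) = 0))"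
proof -
  interpret ev_charging E by (rule ev_charging.intro) (rule assms)
  have "(T, B) \<in> arm_space E i \<Longrightarrow> c0 \<in> costs E \<Longrightarrow> \<tau> < num_periods E \<Longrightarrow>
      ((T, B), c0, \<tau>) \<in> ext_space E i" for T B c0 \<tau> i
    by (simp add: ext_space_def)
  moreover have "(0, 0) \<in> arm_space E i" for i
    by (simp add: arm_space_def)
  ultimately show ?thesis
    using indexable_charger whittle_policy_optimal whittle_index_constant_cost whittle_index_dummy
    by (simp add: mab_indexable_def)
qed

end
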